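(* Let $N=\{1,2,3\}$ and $O=\{a,b,c\}$, and let $\mathcal{S}$ be the set of the six House Allocation instances with agents $N$ and objects $O$ obtained by assigning the three preference lists $(a)$, $(a\succ b)$, $(a\succ b\succ c)$ to the three agents in all $3!$ possible ways. For every deterministic truthful and Pareto optimal mechanism $\phi$ for House Allocation with strict preferences (with agents $N$ and objects $O$), the sum $\#^{\phi}(\mathcal{S})=\sum_{I\in\mathcal{S}}|\phi(I)|$ of the sizes of the matchings returned by $\phi$ on the six instances of $\mathcal{S}$ satisfies $\#^{\phi}(\mathcal{S})\le 13$. Consequently, every universally truthful and Pareto optimal (randomised) mechanism for House Allocation with strict preferences has an approximation ratio of at least $\frac{18}{13}$.
   Context: House Allocation with strict preferences (unweighted). An instance has a finite set $N$ of agents and a finite set $O$ of objects; each agent $i$ has a preference list $L(i)$, a strict linear order on a subset of $O$ (his acceptable objects; the list may be incomplete). A matching is a set of (agent, acceptable object) pairs in which every agent and every object occurs at most once; its size is the number of pairs. Agents prefer acceptable objects according to their lists, and prefer every acceptable object to being unmatched; receiving an object unacceptable with respect to the true list counts the same as being unmatched. A matching $\mu$ is Pareto optimal if there is no matching $\mu'$ with $\mu'(i)\succeq_i\mu(i)$ for all agents $i$ and $\mu'(i')\succ_{i'}\mu(i')$ for some agent $i'$. A deterministic mechanism $\phi$ maps each instance to a matching of that instance. It is Pareto optimal if it always returns a Pareto optimal matching, and truthful if for every profile $L$, every agent $i$ and every alternative list $L'(i)$, the outcome of $i$ under $\phi(L(i),L(-i))$ is weakly preferred by $i$, according to $L(i)$,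 to his outcome under $\phi(L'(i),L(-i))$. A universally truthful and Pareto optimal mechanism is a probability distribution over deterministic truthful and Pareto optimal mechanisms. The approximation ratio of a (randomised) mechanism is the maximum (supremum) over instances $I$ of (maximum size of a matching in $I$) divided by (expected size of the matching returned on $I$). *)

theory Defs
  imports "HOL-Probability.Probability"
begin

text \<open>
  A preference list \<open>prefs I i\<close> is a strict linear order on the set of objects acceptable to
  \<open>i\<close>, represented by listing these objects from best to worst.
\<close>

record ('a, 'o) ha_instance =
  agents :: "'a set"
  objects :: "'o set"
  prefs :: "'a \<Rightarrow> 'o list"

text \<open>
  The lists of non-agents are fixed to \<open>[]\<close>, so that an instance carries no information besides
  its agents, its objects and the agents' lists.
\<close>

definition ha_instances :: "('a, 'o) ha_instance set" where
  "ha_instances = {I. finite (agents I) \<and> finite (objects I)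
     \<and> (\<forall>i\<in>agents I. distinct (prefs I i) \<and> set (prefs I i) \<subseteq> objects I)
     \<and> (\<forall>i. i \<notin> agents I \<longrightarrow> prefs I i = [])}"

definition ha_instances_on :: "'a set \<Rightarrow> 'o set \<Rightarrow> ('a, 'o) ha_instance set" where
  "ha_instances_on N O' = {I \<in> ha_instances. agents I = N \<and> objects I = O'}"

definition matching :: "('a, 'o) ha_instance \<Rightarrow> ('a \<times> 'o) set \<Rightarrow> bool" where
  "matching I \<mu> \<longleftrightarrow>
     (\<forall>(i, x)\<in>\<mu>. i \<in> agents I \<and> x \<in> set (prefs I i))
     \<and> (\<forall>i x y. (i, x) \<in> \<mu> \<and> (i, y) \<in> \<mu> \<longrightarrow> x = y)
     \<and> (\<forall>i j x. (i, x) \<in> \<mu> \<and> (j, x) \<in> \<mu> \<longrightarrow> i = j)"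

definition max_matching_size :: "('a, 'o) ha_instance \<Rightarrow> nat" where
  "max_matching_size I = Max {card \<mu> |\<mu>. matching I \<mu>}"

text \<open>The outcome of an agent; \<open>None\<close> means unmatched.\<close>

definition outcome :: "('a \<times> 'o) set \<Rightarrow> 'a \<Rightarrow> 'o option" where
  "outcome \<mu> i = (if \<exists>x. (i, x) \<in> \<mu> then Some (THE x. (i, x) \<in> \<mu>) else None)"

text \<open>
  Outcome \<open>x\<close> is strictly better than \<open>y\<close> for an agent with list \<open>l\<close> iff \<open>x\<close> is an object on
  \<open>l\<close> and \<open>y\<close> does not occur on \<open>l\<close> at or before the position of \<open>x\<close>. Hence being unmatched and
  receiving an object not on \<open>l\<close> are equally good, and worse than any object on \<open>l\<close>. Since the
  order is total up to this indifference, weak preference is the negated converse.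
\<close>

definition prefers :: "'o list \<Rightarrow> 'o option \<Rightarrow> 'o option \<Rightarrow> bool" where
  "prefers l x y \<longleftrightarrow> (\<exists>p<length l. x = Some (l ! p) \<and> (\<forall>q\<le>p. y \<noteq> Some (l ! q)))"

definition weakly_prefers :: "'o list \<Rightarrow> 'o option \<Rightarrow> 'o option \<Rightarrow> bool" where
  "weakly_prefers l x y \<longleftrightarrow> \<not> prefers l y x"

definition pareto_optimal :: "('a, 'o) ha_instance \<Rightarrow> ('a \<times> 'o) set \<Rightarrow> bool" where
  "pareto_optimal I \<mu> \<longleftrightarrow> matching I \<mu> \<and>
     \<not> (\<exists>\<mu>'. matching I \<mu>'
          \<and> (\<forall>i\<in>agents I. weakly_prefers (prefs I i) (outcome \<mu>' i) (outcome \<mu> i))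
          \<and> (\<exists>i\<in>agents I. prefers (prefs I i) (outcome \<mu>' i) (outcome \<mu> i)))"

text \<open>
  A deterministic mechanism is a function on instances. The set \<open>D\<close> is its domain: all instances,
  or all instances with given agents and objects. Values outside \<open>D\<close> are irrelevant.
\<close>

type_synonym ('a, 'o) mechanism = "('a, 'o) ha_instance \<Rightarrow> ('a \<times> 'o) set"

definition mechanism_on :: "('a, 'o) ha_instance set \<Rightarrow> ('a, 'o) mechanism \<Rightarrow> bool" where
  "mechanism_on D \<phi> \<longleftrightarrow> (\<forall>I\<in>D. matching I (\<phi> I))"

definition pareto_optimal_on :: "('a, 'o) ha_instance set \<Rightarrow> ('a, 'o) mechanism \<Rightarrow> bool" where
  "pareto_optimal_on D \<phi> \<longleftrightarrow> (\<forall>I\<in>D. pareto_optimal I (\<phi> I))"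

definition truthful_on :: "('a, 'o) ha_instance set \<Rightarrow> ('a, 'o) mechanism \<Rightarrow> bool" where
  "truthful_on D \<phi> \<longleftrightarrow>
     (\<forall>I\<in>D. \<forall>i\<in>agents I. \<forall>l. distinct l \<and> set l \<subseteq> objects I \<longrightarrow>
        weakly_prefers (prefs I i)
          (outcome (\<phi> I) i)
          (outcome (\<phi> (I\<lparr>prefs := (prefs I)(i := l)\<rparr>)) i))"

definition truthful_pareto_mechanisms_on ::
    "('a, 'o) ha_instance set \<Rightarrow> ('a, 'o) mechanism set" where
  "truthful_pareto_mechanisms_on D =
     {\<phi>. mechanism_on D \<phi> \<and> truthful_on D \<phi> \<and> pareto_optimal_on D \<phi>}"

text \<open>
  There may be uncountably many deterministic mechanisms, so a distribution over them is a
  probability measure, on any \<open>\<sigma>\<close>-algebra for which the matching returned on each instance is a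
  random variable.
\<close>

definition universally_truthful_pareto_optimal :: "('a, 'o) mechanism measure \<Rightarrow> bool" where
  "universally_truthful_pareto_optimal M \<longleftrightarrow>
     prob_space M
     \<and> space M \<subseteq> truthful_pareto_mechanisms_on ha_instances
     \<and> (\<forall>I\<in>ha_instances. (\<lambda>\<phi>. \<phi> I) \<in> measurable M (count_space UNIV))"

definition expected_size :: "('a, 'o) mechanism measure \<Rightarrow> ('a, 'o) ha_instance \<Rightarrow> ennreal" where
  "expected_size M I = (\<integral>\<^sup>+ \<phi>. of_nat (card (\<phi> I)) \<partial>M)"

text \<open>
  In \<open>ennreal\<close> we have \<open>0 / 0 = 0\<close>, so instances that admit only the empty matching do not
  contribute to the supremum, while \<open>x / 0 = \<infinity>\<close> for \<open>x > 0\<close>.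
\<close>

definition approximation_ratio :: "('a, 'o) mechanism measure \<Rightarrow> ennreal" where
  "approximation_ratio M =
     (SUP I\<in>ha_instances. of_nat (max_matching_size I) / expected_size M I)"

text \<open>The instances obtained by distributing the lists in \<open>\<L>\<close> bijectively among the agents.\<close>

definition list_assignment_instances ::
    "'a set \<Rightarrow> 'o set \<Rightarrow> 'o list set \<Rightarrow> ('a, 'o) ha_instance set" where
  "list_assignment_instances N O' \<L> = {I \<in> ha_instances_on N O'. bij_betw (prefs I) N \<L>}"

lemma card_three_list_instances:
  assumes "distinct [a, b, c]"
  shows "card (list_assignment_instances {1, 2, 3 :: nat} {a, b, c} {[a], [a, b], [a, b, c]}) = 6"
proof -
  let ?L = "{[a], [a, b], [a, b, c]}"
  let ?mk = "\<lambda>(x, y, z). \<lparr>agents = {1, 2, 3 :: nat}, objects = {a, b, c},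
                prefs = (\<lambda>_. [])(1 := x, 2 := y, 3 := z)\<rparr>"
  let ?T = "{([a], [a, b], [a, b, c]), ([a], [a, b, c], [a, b]), ([a, b], [a], [a, b, c]),
             ([a, b], [a, b, c], [a]), ([a, b, c], [a], [a, b]), ([a, b, c], [a, b], [a])}"
  have inj: "inj_on ?mk ?T"
  proof (rule inj_on_subset[OF _ subset_UNIV], rule inj_on_inverseI)
    show "(prefs (?mk t) 1, prefs (?mk t) 2, prefs (?mk t) 3) = t" for t
      by (cases t) simp
  qed
  have "list_assignment_instances {1, 2, 3 :: nat} {a, b, c} ?L = ?mk ` ?T" (is "?S = _")
  proof (intro equalityI subsetI)
    fix I assume I: "I \<in> ?S"
    then have b: "bij_betw (prefs I) {1, 2, 3} ?L" and
      n: "\<And>i. i \<notin> {1, 2, 3} \<Longrightarrow> prefs I i = []" and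
      ao: "agents I = {1, 2, 3}" "objects I = {a, b, c}"
      by (auto simp: list_assignment_instances_def ha_instances_on_def ha_instances_def)
    have eq: "I = ?mk (prefs I 1, prefs I 2, prefs I 3)"
    proof -
      have "prefs I = (\<lambda>_. [])(1 := prefs I 1, 2 := prefs I 2, 3 := prefs I 3)"
        using n by (intro ext) simp
      with ao show ?thesis by simp
    qed
    have "(prefs I 1, prefs I 2, prefs I 3) \<in> ?T"
    proof -
      have "prefs I 1 \<in> ?L" "prefs I 2 \<in> ?L" "prefs I 3 \<in> ?L"
        using bij_betwE[OF b] by blast+
      moreover have "prefs I 1 \<noteq> prefs I 2" "prefs I 1 \<noteq> prefs I 3" "prefs I 2 \<noteq> prefs I 3"
        using inj_onD[OF bij_betw_imp_inj_on[OF b]] by fastforce+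
      ultimately show ?thesis
        by - (elim insertE emptyE, simp_all)
    qed
    then show "I \<in> ?mk ` ?T" using eq by blast
  next
    fix I assume "I \<in> ?mk ` ?T"
    then obtain x y z where t: "(x, y, z) \<in> ?T" and I: "I = ?mk (x, y, z)"
      by (elim imageE, metis prod_cases3)
    have xyz: "distinct [x, y, z]" "{x, y, z} = ?L"
      using t unfolding insert_iff empty_iff prod.inject by (elim disjE conjE FalseE; force)+
    then have "\<forall>l\<in>{x, y, z}. distinct l \<and> set l \<subseteq> {a, b, c}" using assms by simp
    moreover have "bij_betw (prefs I) {1, 2, 3} ?L"
      unfolding xyz(2)[symmetric] using xyz(1) by (simp add: I bij_betw_def)
    ultimately show "I \<in> ?S"
      by (simp add: I list_assignment_instances_def ha_instances_on_def ha_instances_def)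
  qed
  then show ?thesis
    by (simp only: card_image[OF inj]) simp
qed

end

theory Submission
  imports Defs
begin

text \<open>
  On an instance of \<open>S\<close> a matching of size 3 gives \<open>a\<close>, \<open>b\<close>, \<open>c\<close> to the agents \<open>p\<close>, \<open>q\<close>, \<open>r\<close> with
  lists \<open>(a)\<close>, \<open>(a \<succ> b)\<close>, \<open>(a \<succ> b \<succ> c)\<close> respectively. If \<open>r\<close> shortens his list to \<open>(a \<succ> b)\<close>, he is
  unmatched by truthfulness, so by Pareto optimality \<open>b\<close> and then \<open>a\<close> are assigned to others,
  which is only possible with \<open>p\<close> getting \<open>a\<close> and \<open>q\<close> getting \<open>b\<close>. If \<open>p\<close> then extends his list to
  \<open>(a \<succ> b)\<close>, he keeps \<open>a\<close>. The last profile is the same for all instances of \<open>S\<close>, hence \<open>p\<close> is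
  determined by the mechanism. The profile before it depends on \<open>p\<close> only, hence \<open>q\<close> is determined
  too. So at most one of the six matchings has size 3. Averaging over the six instances, which all
  have a maximum matching of size 3, gives the bound for distributions over mechanisms.
\<close>

section \<open>Outcomes and sizes of matchings\<close>

lemma outcome_eq_Some_iff:
  assumes "matching I \<mu>"
  shows "outcome \<mu> i = Some x \<longleftrightarrow> (i, x) \<in> \<mu>"
proof -
  have "(THE y. (i, y) \<in> \<mu>) = z" if "(i, z) \<in> \<mu>" for z
    using assms that unfolding matching_def by blast
  then show ?thesis
    unfolding outcome_def by auto
qed

lemma outcome_eq_None_iff: "outcome \<mu> i = None \<longleftrightarrow> (\<forall>x. (i, x) \<notin> \<mu>)"
  by (simp add: outcome_def)

lemma matching_acceptable:
  "matching I \<mu> \<Longrightarrow> (i, x) \<in> \<mu> \<Longrightarrow> i \<in> agents I \<and> x \<in> set (prefs I i)"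
  unfolding matching_def by auto

lemma matching_object_unique: "matching I \<mu> \<Longrightarrow> (i, x) \<in> \<mu> \<Longrightarrow> (i, y) \<in> \<mu> \<Longrightarrow> x = y"
  unfolding matching_def by blast

lemma matching_agent_unique: "matching I \<mu> \<Longrightarrow> (i, x) \<in> \<mu> \<Longrightarrow> (j, x) \<in> \<mu> \<Longrightarrow> i = j"
  unfolding matching_def by blast

lemma matching_subset:
  assumes "I \<in> ha_instances" "matching I \<mu>"
  shows "\<mu> \<subseteq> agents I \<times> objects I"
proof
  fix z assume "z \<in> \<mu>"
  then show "z \<in> agents I \<times> objects I"
    using matching_acceptable[OF assms(2), of "fst z" "snd z"] assms(1)
    by (cases z) (auto simp: ha_instances_def)
qed

lemma inj_on_fst_matching: "matching I \<mu> \<Longrightarrow> inj_on fst \<mu>"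
  unfolding matching_def inj_on_def by auto

lemma card_matching_le:
  assumes "I \<in> ha_instances" "matching I \<mu>"
  shows "card \<mu> \<le> card (agents I)"
proof (rule card_inj_on_le[OF inj_on_fst_matching[OF assms(2)]])
  show "fst ` \<mu> \<subseteq> agents I"
    using matching_subset[OF assms] by auto
  show "finite (agents I)"
    using assms(1) by (simp add: ha_instances_def)
qed

text \<open>\<open>fst\<close> is injective on a matching, so with as many pairs as agents its image
  fills the finite set of agents.\<close>

lemma matching_card_eq_agents:
  assumes "I \<in> ha_instances" "matching I \<mu>" "card \<mu> = card (agents I)" "i \<in> agents I"
  obtains x where "(i, x) \<in> \<mu>"
proof -
  have "fst ` \<mu> = agents I"
  proof (rule card_subset_eq)
    show "finite (agents I)"
      using assms(1) by (simp add: ha_instances_def)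
    show "fst ` \<mu> \<subseteq> agents I"
      using matching_subset[OF assms(1,2)] by auto
    show "card (fst ` \<mu>) = card (agents I)"
      using card_image[OF inj_on_fst_matching[OF assms(2)]] assms(3) by simp
  qed
  with assms(4) show thesis
    using that by force
qed

lemma card_matching_le_max_matching_size:
  assumes "I \<in> ha_instances" "matching I \<mu>"
  shows "card \<mu> \<le> max_matching_size I"
  unfolding max_matching_size_def
proof (rule Max_ge)
  \<comment> \<open>\<open>Max_ge\<close> requires a finite set; the number of agents bounds every
    size.\<close>
  have "{card \<mu> |\<mu>. matching I \<mu>} \<subseteq> {..card (agents I)}"
    using card_matching_le[OF assms(1)] by auto
  then show "finite {card \<mu> |\<mu>. matching I \<mu>}"
    using finite_subset by blast
qed (use assms(2) in blast)

section \<open>Consequences of Pareto optimality and truthfulness\<close>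

lemma pareto_optimal_nonwasteful:
  assumes po: "pareto_optimal I \<mu>" and i: "i \<in> agents I" and x: "x \<in> set (prefs I i)"
    and unmatched: "\<forall>y. (i, y) \<notin> \<mu>"
  shows "\<exists>j. (j, x) \<in> \<mu>"
proof (rule ccontr)
  assume free: "\<nexists>j. (j, x) \<in> \<mu>"
  \<comment> \<open>Giving the free object \<open>x\<close> to the unmatched agent \<open>i\<close>
    improves \<open>i\<close> and leaves all other outcomes unchanged.\<close>
  let ?\<mu>' = "insert (i, x) \<mu>"
  have m: "matching I \<mu>"
    using po by (simp add: pareto_optimal_def)
  have m': "matching I ?\<mu>'"
    using m i x unmatched free unfolding matching_def by (simp; blast)
  obtain p where p: "p < length (prefs I i)" "prefs I i ! p = x"
    using x by (auto simp: in_set_conv_nth)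
  have out_i: "outcome \<mu> i = None" "outcome ?\<mu>' i = Some x"
    using unmatched outcome_eq_Some_iff[OF m', of i x] by (auto simp: outcome_eq_None_iff)
  have better: "prefers (prefs I i) (outcome ?\<mu>' i) (outcome \<mu> i)"
    using p by (auto simp: out_i prefers_def)
  have "weakly_prefers (prefs I j) (outcome ?\<mu>' j) (outcome \<mu> j)" for j
  proof (cases "j = i")
    case True
    then show ?thesis
      by (simp add: out_i weakly_prefers_def prefers_def)
  next
    case False
    then have "outcome ?\<mu>' j = outcome \<mu> j"
      by (simp add: outcome_def)
    then show ?thesis
      by (auto simp: weakly_prefers_def prefers_def)
  qed
  with m' better i po show False
    unfolding pareto_optimal_def by blast
qed

text \<open>Since \<open>l\<close> is distinct, \<open>k\<close> is the only position of
  \<open>l ! k\<close>. This turns weak preference, defined by negation, into a comparison of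
  positions.\<close>

lemma weakly_prefers_nth_iff:
  assumes "distinct l" "k < length l"
  shows "weakly_prefers l y (Some (l ! k)) \<longleftrightarrow> (\<exists>q\<le>k. y = Some (l ! q))"
proof
  assume "weakly_prefers l y (Some (l ! k))"
  then show "\<exists>q\<le>k. y = Some (l ! q)"
    using assms(2) unfolding weakly_prefers_def prefers_def by blast
next
  assume "\<exists>q\<le>k. y = Some (l ! q)"
  then obtain q where q: "q \<le> k" "y = Some (l ! q)"
    by blast
  have "\<not> prefers l (Some (l ! k)) y"
  proof
    assume "prefers l (Some (l ! k)) y"
    then obtain p where p: "p < length l" "l ! k = l ! p" "\<forall>q\<le>p. y \<noteq> Some (l ! q)"
      unfolding prefers_def by auto
    then have "p = k"
      using assms nth_eq_iff_index_eq by metis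
    with p q show False
      by blast
  qed
  then show "weakly_prefers l y (Some (l ! k))"
    by (simp add: weakly_prefers_def)
qed

text \<open>Truthfulness is applied in both directions between the lists \<open>l @ l1\<close> and
  \<open>l @ l2\<close>. Under \<open>l @ l2\<close> the agent gets an object at or before
  \<open>x\<close>, as he could report \<open>l @ l1\<close>; that object cannot precede
  \<open>x\<close>, as otherwise he would report \<open>l @ l2\<close> when his list is
  \<open>l @ l1\<close>. Up to the position of \<open>x\<close> both lists agree with
  \<open>l\<close>.\<close>

lemma truthful_common_prefix:
  assumes \<phi>: "\<phi> \<in> truthful_pareto_mechanisms_on (ha_instances_on N O')"
    and I: "I \<in> ha_instances_on N O'" and i: "i \<in> N"
    and l1: "prefs I i = l @ l1"
    and l2: "distinct (l @ l2)" "set (l @ l2) \<subseteq> O'"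
    and x: "x \<in> set l" "(i, x) \<in> \<phi> I"
  shows "(i, x) \<in> \<phi> (I\<lparr>prefs := (prefs I)(i := l @ l2)\<rparr>)"
proof -
  let ?J = "I\<lparr>prefs := (prefs I)(i := l @ l2)\<rparr>"
  have J: "?J \<in> ha_instances_on N O'"
    using I i l2 by (auto simp: ha_instances_on_def ha_instances_def)
  \<comment> \<open>This exhibits \<open>I\<close> as the result of a misreport at
    \<open>?J\<close>.\<close>
  have revert: "?J\<lparr>prefs := (prefs ?J)(i := l @ l1)\<rparr> = I"
    by (simp flip: l1)
  have l1': "distinct (l @ l1)" "set (l @ l1) \<subseteq> O'"
    using I i by (auto simp: ha_instances_on_def ha_instances_def simp flip: l1 distinct_append set_append)
  have mI: "matching I (\<phi> I)" and mJ: "matching ?J (\<phi> ?J)"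
    and T: "truthful_on (ha_instances_on N O') \<phi>"
    using \<phi> I J by (auto simp: truthful_pareto_mechanisms_on_def mechanism_on_def)
  have truthful: "weakly_prefers (prefs H i) (outcome (\<phi> H) i)
      (outcome (\<phi> (H\<lparr>prefs := (prefs H)(i := l')\<rparr>)) i)"
    if "H \<in> ha_instances_on N O'" "distinct l'" "set l' \<subseteq> O'" for H l'
    using T i that unfolding truthful_on_def ha_instances_on_def by blast
  have outI: "outcome (\<phi> I) i = Some x"
    using outcome_eq_Some_iff[OF mI] x by simp
  obtain k where k: "k < length l" "l ! k = x"
    using x by (auto simp: in_set_conv_nth)
  have nth: "(l @ l') ! q = l ! q" if "q \<le> k" for l' q
    using that k by (simp add: nth_append)
  have "weakly_prefers (prefs ?J i) (outcome (\<phi> ?J) i)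
      (outcome (\<phi> (?J\<lparr>prefs := (prefs ?J)(i := l @ l1)\<rparr>)) i)"
    by (rule truthful[OF J l1'])
  then have "weakly_prefers (l @ l2) (outcome (\<phi> ?J) i) (Some ((l @ l2) ! k))"
    unfolding revert outI by (simp add: nth k(2))
  then obtain q where q: "q \<le> k" "outcome (\<phi> ?J) i = Some (l ! q)"
    using weakly_prefers_nth_iff[OF l2(1), of k] k(1) by (auto simp: nth)
  have "weakly_prefers (l @ l1) (Some x) (outcome (\<phi> ?J) i)"
    using truthful[OF I l2] unfolding outI l1 .
  then have "weakly_prefers (l @ l1) (Some x) (Some ((l @ l1) ! q))"
    using q nth by simp
  then obtain q' where "q' \<le> q" "x = (l @ l1) ! q'"
    using weakly_prefers_nth_iff[OF l1'(1), of q] q(1) k(1) by auto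
  then have "l ! q' = l ! k" "q' \<le> q"
    using k(2) q(1) nth by auto
  moreover have "distinct l"
    using l2(1) by simp
  \<comment> \<open>Distinctness gives \<open>q' = k\<close>, and \<open>q' \<le> q \<le> k\<close>
    squeezes \<open>q\<close>.\<close>
  ultimately have "q = k"
    using q(1) k(1) nth_eq_iff_index_eq[of l q' k] by linarith
  with q k show ?thesis
    using outcome_eq_Some_iff[OF mJ] by simp
qed

text \<open>All three conditions are universal over the domain. Hence mechanisms on all instances
  inherit bounds proved for fixed agents and objects.\<close>

lemma truthful_pareto_mechanisms_on_mono:
  "D \<subseteq> E \<Longrightarrow> truthful_pareto_mechanisms_on E \<subseteq> truthful_pareto_mechanisms_on D"
  unfolding truthful_pareto_mechanisms_on_def mechanism_on_def truthful_on_def pareto_optimal_on_def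
  by blast

section \<open>Full matchings on the instances of \<open>S\<close>\<close>

text \<open>Both conclusions name explicit profiles so that different \<open>I\<close> can be
  compared: the first profile depends on \<open>I\<close> only through \<open>p\<close>, the second
  not at all.\<close>

lemma three_list_instance_full_matching:
  assumes dist: "distinct [a, b, c]" "distinct [p, q, r]"
    and N: "N = {p, q, r}" and O': "O' = {a, b, c}"
    and \<phi>: "\<phi> \<in> truthful_pareto_mechanisms_on (ha_instances_on N O')"
    and I: "I \<in> ha_instances_on N O'"
    and prefs: "prefs I p = [a]" "prefs I q = [a, b]" "prefs I r = [a, b, c]"
    and card: "card (\<phi> I) = 3"
  shows "(q, b) \<in> \<phi> \<lparr>agents = N, objects = O',
             prefs = \<lambda>i. if i = p then [a] else if i \<in> N then [a, b] else []\<rparr>"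
    and "(p, a) \<in> \<phi> \<lparr>agents = N, objects = O', prefs = \<lambda>i. if i \<in> N then [a, b] else []\<rparr>"
proof -
  let ?J = "\<lparr>agents = N, objects = O',
             prefs = \<lambda>i. if i = p then [a] else if i \<in> N then [a, b] else []\<rparr>"
  let ?K = "\<lparr>agents = N, objects = O', prefs = \<lambda>i. if i \<in> N then [a, b] else []\<rparr>"
  have agI: "agents I = N" "objects I = O'" "I \<in> ha_instances"
    and nil: "\<And>i. i \<notin> N \<Longrightarrow> prefs I i = []"
    using I by (auto simp: ha_instances_on_def ha_instances_def)
  have J: "?J \<in> ha_instances_on N O'"
    using dist by (auto simp: ha_instances_on_def ha_instances_def N O')
  have mI: "matching I (\<phi> I)" and mJ: "matching ?J (\<phi> ?J)" and poJ: "pareto_optimal ?J (\<phi> ?J)"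
    using \<phi> I J
    by (auto simp: truthful_pareto_mechanisms_on_def mechanism_on_def pareto_optimal_on_def)
  \<comment> \<open>The appended form exposes the common prefix: \<open>?J\<close> becomes
    \<open>I\<close> when \<open>r\<close> appends \<open>c\<close>, and \<open>?K\<close> when
    \<open>p\<close> appends \<open>b\<close>.\<close>
  have JI: "?J\<lparr>prefs := (prefs ?J)(r := [a, b] @ [c])\<rparr> = I"
  proof -
    have "(prefs ?J)(r := [a, b] @ [c]) = prefs I"
      using prefs nil dist by (auto simp: N fun_eq_iff)
    then show ?thesis
      using agI by simp
  qed
  have JK: "?J\<lparr>prefs := (prefs ?J)(p := [a] @ [b])\<rparr> = ?K"
    by (auto simp: N fun_eq_iff)

  \<comment> \<open>All three agents are matched, so \<open>p\<close> takes \<open>a\<close>, which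
    leaves \<open>b\<close> for \<open>q\<close> and \<open>c\<close> for \<open>r\<close>.\<close>
  have rI: "(r, c) \<in> \<phi> I"
  proof -
    have "card (agents I) = 3"
      using dist by (simp add: agI N)
    then have full: "card (\<phi> I) = card (agents I)"
      using card by simp
    have "p \<in> agents I" "q \<in> agents I" "r \<in> agents I"
      by (simp_all add: agI N)
    then obtain x y z where xyz: "(p, x) \<in> \<phi> I" "(q, y) \<in> \<phi> I" "(r, z) \<in> \<phi> I"
      using matching_card_eq_agents[OF agI(3) mI full] by metis
    then have "x \<in> {a}" "y \<in> {a, b}" "z \<in> {a, b, c}"
      using xyz[THEN matching_acceptable[OF mI]] prefs by auto
    moreover have "x \<noteq> y" "x \<noteq> z" "y \<noteq> z"
      using xyz matching_agent_unique[OF mI] dist(2) by auto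
    ultimately show ?thesis
      using xyz by auto
  qed
  \<comment> \<open>Anything \<open>r\<close> receives in \<open>?J\<close> lies in the prefix
    \<open>[a, b]\<close> and would be kept in \<open>I\<close>, where \<open>r\<close> gets
    \<open>c\<close>.\<close>
  have r_unmatched: "(r, x) \<notin> \<phi> ?J" for x
  proof
    assume x: "(r, x) \<in> \<phi> ?J"
    then have "x \<in> set [a, b]"
      using matching_acceptable[OF mJ x] dist by (auto simp: N)
    from truthful_common_prefix[OF \<phi> J _ _ _ _ this x, of "[]" "[c]"]
    have "(r, x) \<in> \<phi> I"
      unfolding JI using dist by (auto simp: N O')
    with rI have "x = c"
      by (rule matching_object_unique[OF mI, symmetric])
    with \<open>x \<in> set [a, b]\<close> dist show False
      by auto
  qed
  have taken: "\<exists>j. (j, x) \<in> \<phi> ?J" if "x \<in> {a, b}" for x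
    by (rule pareto_optimal_nonwasteful[OF poJ, of r]) (use that r_unmatched dist in \<open>auto simp: N\<close>)
  have acc: "j \<in> {p, q} \<and> (j = p \<longrightarrow> x = a)" if "(j, x) \<in> \<phi> ?J" for j x
  proof -
    have "j \<noteq> r"
      using that r_unmatched by blast
    then show ?thesis
      using matching_acceptable[OF mJ that] dist by (auto simp: N split: if_splits)
  qed
  \<comment> \<open>Only \<open>p\<close> and \<open>q\<close> hold objects and \<open>p\<close>
    accepts only \<open>a\<close>, so \<open>b\<close> is with \<open>q\<close>; then
    \<open>a\<close> must be with \<open>p\<close>.\<close>
  show qJ: "(q, b) \<in> \<phi> ?J"
    using taken[of b] acc dist by force
  have pJ: "(p, a) \<in> \<phi> ?J"
  proof -
    have "(q, a) \<notin> \<phi> ?J"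
      using matching_object_unique[OF mJ qJ] dist by auto
    then show ?thesis
      using taken[of a] acc by blast
  qed
  from truthful_common_prefix[OF \<phi> J, of p "[a]" "[]" "[b]" a]
  show "(p, a) \<in> \<phi> ?K"
    unfolding JK using pJ dist by (auto simp: N O')
qed

text \<open>Naming the agents by their lists lets one argument cover all six assignments.\<close>

lemma list_assignment_instances_threeE:
  assumes "distinct [a, b, c]"
    and I: "I \<in> list_assignment_instances N O' {[a], [a, b], [a, b, c]}"
  obtains p q r where "distinct [p, q, r]" "N = {p, q, r}"
    "prefs I p = [a]" "prefs I q = [a, b]" "prefs I r = [a, b, c]"
proof -
  have bij: "bij_betw (prefs I) N {[a], [a, b], [a, b, c]}"
    using I by (simp add: list_assignment_instances_def)
  then have im: "prefs I ` N = {[a], [a, b], [a, b, c]}" and inj: "inj_on (prefs I) N"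
    by (auto simp: bij_betw_def)
  have "[a] \<in> prefs I ` N" "[a, b] \<in> prefs I ` N" "[a, b, c] \<in> prefs I ` N"
    unfolding im by simp_all
  then obtain p q r where pqr: "p \<in> N" "q \<in> N" "r \<in> N"
    "prefs I p = [a]" "prefs I q = [a, b]" "prefs I r = [a, b, c]"
    by (elim imageE) metis
  have "i \<in> {p, q, r}" if "i \<in> N" for i
  proof -
    have "prefs I i \<in> {prefs I p, prefs I q, prefs I r}"
      using im that pqr(4-6) by auto
    then show ?thesis
      using inj_onD[OF inj] that pqr(1-3) by blast
  qed
  with pqr have "N = {p, q, r}"
    by blast
  moreover have "distinct [p, q, r]"
    using pqr by auto
  ultimately show thesis
    using that pqr by blast
qed

lemma three_list_full_matching_unique:
  assumes dist: "distinct [a, b, c]" and O': "O' = {a, b, c}"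
    and \<phi>: "\<phi> \<in> truthful_pareto_mechanisms_on (ha_instances_on N O')"
    and I: "I \<in> list_assignment_instances N O' {[a], [a, b], [a, b, c]}" "card (\<phi> I) = 3"
    and I': "I' \<in> list_assignment_instances N O' {[a], [a, b], [a, b, c]}" "card (\<phi> I') = 3"
  shows "I = I'"
proof -
  obtain p q r where pqr: "distinct [p, q, r]" "N = {p, q, r}"
    "prefs I p = [a]" "prefs I q = [a, b]" "prefs I r = [a, b, c]"
    using list_assignment_instances_threeE[OF dist I(1)] .
  obtain p' q' r' where pqr': "distinct [p', q', r']" "N = {p', q', r'}"
    "prefs I' p' = [a]" "prefs I' q' = [a, b]" "prefs I' r' = [a, b, c]"
    using list_assignment_instances_threeE[OF dist I'(1)] .
  have D: "I \<in> ha_instances_on N O'" "I' \<in> ha_instances_on N O'"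
    using I I' by (auto simp: list_assignment_instances_def)
  note full = three_list_instance_full_matching[OF dist pqr(1,2) O' \<phi> D(1) pqr(3-5) I(2)]
  note full' = three_list_instance_full_matching[OF dist pqr'(1,2) O' \<phi> D(2) pqr'(3-5) I'(2)]
  have m: "matching J (\<phi> J)" if "J \<in> ha_instances_on N O'" for J
    using \<phi> that by (auto simp: truthful_pareto_mechanisms_on_def mechanism_on_def)
  have unique: "i = j" if "J \<in> ha_instances_on N O'" "(i, x) \<in> \<phi> J" "(j, x) \<in> \<phi> J" for J i j x
    using matching_agent_unique[OF m] that by blast
  have "p = p'"
    by (rule unique[OF _ full(2) full'(2)])
      (use dist pqr(2) in \<open>auto simp: ha_instances_on_def ha_instances_def O'\<close>)
  \<comment> \<open>Once \<open>p = p'\<close>, the first conclusions for \<open>I\<close> and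
    \<open>I'\<close> concern the same profile.\<close>
  have "q = q'"
    by (rule unique[OF _ full(1) full'(1)[folded \<open>p = p'\<close>]])
      (use dist pqr(2) in \<open>auto simp: ha_instances_on_def ha_instances_def O'\<close>)
  have "r = r'"
    using pqr(1,2) pqr'(1,2) \<open>p = p'\<close> \<open>q = q'\<close> by auto
  have "prefs I i = prefs I' i" for i
    using pqr pqr' D \<open>p = p'\<close> \<open>q = q'\<close> \<open>r = r'\<close>
    by (cases "i \<in> N") (auto simp: ha_instances_on_def ha_instances_def)
  with D show ?thesis
    by (auto simp: ha_instances_on_def intro!: ha_instance.equality)
qed

lemma sum_card_three_list_instances_le:
  assumes dist: "distinct [a, b, c]"
    and S: "S = list_assignment_instances {1, 2, 3 :: nat} {a, b, c} {[a], [a, b], [a, b, c]}"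
    and \<phi>: "\<phi> \<in> truthful_pareto_mechanisms_on (ha_instances_on {1, 2, 3} {a, b, c})"
  shows "(\<Sum>I\<in>S. card (\<phi> I)) \<le> 13"
proof -
  let ?F = "{I \<in> S. card (\<phi> I) = 3}"
  have card_S: "card S = 6"
    unfolding S by (rule card_three_list_instances[OF dist])
  then have "finite S"
    using card.infinite by fastforce
  have "card ?F \<le> Suc 0"
    using three_list_full_matching_unique[OF dist refl \<phi>] \<open>finite S\<close>
    by (subst card_le_Suc0_iff_eq) (auto simp: S)
  \<comment> \<open>Every size is at most 3, and at most one equals 3, so the total is at most
    \<open>6 * 2 + 1\<close>.\<close>
  have "(\<Sum>I\<in>S. card (\<phi> I)) \<le> (\<Sum>I\<in>S. 2 + of_bool (card (\<phi> I) = 3))"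
  proof (rule sum_mono)
    fix I assume "I \<in> S"
    then have "I \<in> ha_instances_on {1, 2, 3} {a, b, c}"
      by (simp add: S list_assignment_instances_def)
    then have "card (\<phi> I) \<le> 3"
      using card_matching_le[of I "\<phi> I"] \<phi>
      by (auto simp: ha_instances_on_def truthful_pareto_mechanisms_on_def mechanism_on_def)
    then show "card (\<phi> I) \<le> 2 + of_bool (card (\<phi> I) = 3)"
      by auto
  qed
  also have "\<dots> = 12 + card ?F"
    unfolding sum.distrib using \<open>finite S\<close> card_S by (simp add: Int_def)
  also have "\<dots> \<le> 13"
    using \<open>card ?F \<le> Suc 0\<close> by simp
  finally show ?thesis .
qed

lemma three_list_max_matching_size_ge:
  assumes "distinct [a, b, c]"
    and I: "I \<in> list_assignment_instances N O' {[a], [a, b], [a, b, c]}"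
  shows "3 \<le> max_matching_size I"
proof -
  obtain p q r where pqr: "distinct [p, q, r]" "N = {p, q, r}"
    "prefs I p = [a]" "prefs I q = [a, b]" "prefs I r = [a, b, c]"
    using list_assignment_instances_threeE[OF assms] .
  have "I \<in> ha_instances" "agents I = N"
    using I by (auto simp: list_assignment_instances_def ha_instances_on_def)
  moreover from this have "matching I {(p, a), (q, b), (r, c)}"
    using pqr assms(1) by (auto simp: matching_def)
  moreover have "card {(p, a), (q, b), (r, c)} = 3"
    using pqr(1) by simp
  ultimately show ?thesis
    using card_matching_le_max_matching_size by metis
qed

section \<open>From deterministic mechanisms to distributions\<close>

text \<open>By linearity the sum of expectations is the expectation of the sum, which is bounded
  pointwise on \<open>space M\<close>; the total mass is 1.\<close>

lemma sum_expected_size_le: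
  assumes M: "universally_truthful_pareto_optimal M"
    and S: "S \<subseteq> ha_instances"
    and le: "\<And>\<phi>. \<phi> \<in> truthful_pareto_mechanisms_on ha_instances \<Longrightarrow> (\<Sum>I\<in>S. card (\<phi> I)) \<le> n"
  shows "(\<Sum>I\<in>S. expected_size M I) \<le> of_nat n"
proof -
  interpret prob_space M
    using M by (simp add: universally_truthful_pareto_optimal_def)
  have meas: "(\<lambda>\<phi>. of_nat (card (\<phi> I)) :: ennreal) \<in> borel_measurable M" if "I \<in> S" for I
  proof -
    have "(\<lambda>\<phi>. \<phi> I) \<in> measurable M (count_space UNIV)"
      using M S that by (auto simp: universally_truthful_pareto_optimal_def)
    then show ?thesis
      by (rule measurable_compose) simp
  qed
  have "(\<Sum>I\<in>S. expected_size M I) = (\<integral>\<^sup>+ \<phi>. (\<Sum>I\<in>S. of_nat (card (\<phi> I))) \<partial>M)"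
    unfolding expected_size_def by (rule nn_integral_sum[symmetric]) (rule meas)
  also have "\<dots> \<le> (\<integral>\<^sup>+ \<phi>. of_nat n \<partial>M)"
  proof (rule nn_integral_mono)
    fix \<phi> assume "\<phi> \<in> space M"
    then have "(\<Sum>I\<in>S. card (\<phi> I)) \<le> n"
      using M le by (auto simp: universally_truthful_pareto_optimal_def)
    then show "(\<Sum>I\<in>S. of_nat (card (\<phi> I))) \<le> (of_nat n :: ennreal)"
      by (simp flip: of_nat_sum)
  qed
  also have "\<dots> = of_nat n"
    by (simp add: emeasure_space_1)
  finally show ?thesis .
qed

lemma inverse_antimono_ennreal: "x \<le> y \<Longrightarrow> inverse y \<le> inverse (x :: ennreal)"
  including ennreal.lifting by transfer (rule ereal_inverse_antimono)

text \<open>The instance of \<open>S\<close> with the least expected size lies at or below the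
  average, hence at or below \<open>n / card S\<close>, and its own ratio already reaches the
  bound.\<close>

lemma approximation_ratio_ge_average:
  assumes S: "finite S" "S \<noteq> {}" "S \<subseteq> ha_instances"
    and max: "\<And>I. I \<in> S \<Longrightarrow> m \<le> max_matching_size I"
    and le: "(\<Sum>I\<in>S. expected_size M I) \<le> of_nat n" and n: "n > 0"
  shows "ennreal (real m * real (card S) / real n) \<le> approximation_ratio M"
proof -
  obtain I where I: "I \<in> S" "\<And>J. J \<in> S \<Longrightarrow> expected_size M I \<le> expected_size M J"
    using ex_is_arg_min_if_finite[OF S(1,2), of "expected_size M"]
    by (auto simp: is_arg_min_linorder)
  have "of_nat (card S) * expected_size M I \<le> of_nat n"
    using sum_bounded_below[of S "expected_size M I" "expected_size M"] I(2) le by force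
  then have "of_nat (card S) * expected_size M I / of_nat (card S) \<le> of_nat n / of_nat (card S)"
    by (rule divide_right_mono_ennreal)
  moreover have "card S > 0"
    using S by (simp add: card_gt_0_iff)
  ultimately have E: "expected_size M I \<le> ennreal (real n / real (card S))"
    using mult_divide_eq_ennreal[of "of_nat (card S)" "expected_size M I"]
    by (simp add: mult.commute ennreal_of_nat_eq_real_of_nat divide_ennreal)
  have "ennreal (real m * real (card S) / real n) = of_nat m / ennreal (real n / real (card S))"
    using S n by (simp add: ennreal_of_nat_eq_real_of_nat divide_ennreal card_gt_0_iff)
  \<comment> \<open>Antitonicity of \<open>inverse\<close> on \<open>ennreal\<close> also covers
    expected size 0, whose inverse is \<infinity>.\<close>
  also have "\<dots> \<le> of_nat (max_matching_size I) / expected_size M I"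
    unfolding divide_ennreal_def
    using I(1) E max by (intro mult_mono) (auto intro: inverse_antimono_ennreal)
  also have "\<dots> \<le> approximation_ratio M"
    unfolding approximation_ratio_def using I(1) S(3) by (intro SUP_upper) auto
  finally show ?thesis .
qed

theorem theorem6p2:
  fixes a b c :: 'o
    and N :: "nat set"
    and Obj :: "'o set"
    and S :: "(nat, 'o) ha_instance set"
  assumes "distinct [a, b, c]"
    and "N = {1, 2, 3}"
    and "Obj = {a, b, c}"
    and "S = list_assignment_instances N Obj {[a], [a, b], [a, b, c]}"
  shows "(\<forall>\<phi> \<in> truthful_pareto_mechanisms_on (ha_instances_on N Obj).
            (\<Sum>I\<in>S. card (\<phi> I)) \<le> 13)
         \<and> (\<forall>M :: (nat, 'o) mechanism measure.
              universally_truthful_pareto_optimal M \<longrightarrow> 18 / 13 \<le> approximation_ratio M)"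
proof (intro conjI ballI allI impI)
  have S: "S = list_assignment_instances {1, 2, 3} {a, b, c} {[a], [a, b], [a, b, c]}"
    using assms by simp
  show le: "(\<Sum>I\<in>S. card (\<phi> I)) \<le> 13"
    if "\<phi> \<in> truthful_pareto_mechanisms_on (ha_instances_on N Obj)" for \<phi>
    using sum_card_three_list_instances_le[OF assms(1) S] that assms by simp
  fix M :: "(nat, 'o) mechanism measure"
  assume M: "universally_truthful_pareto_optimal M"
  have card_S: "card S = 6"
    unfolding S by (rule card_three_list_instances[OF assms(1)])
  have S_sub: "S \<subseteq> ha_instances"
    unfolding S by (auto simp: list_assignment_instances_def ha_instances_on_def)
  have "truthful_pareto_mechanisms_on ha_instances
      \<subseteq> truthful_pareto_mechanisms_on (ha_instances_on N Obj)"
    by (rule truthful_pareto_mechanisms_on_mono) (auto simp: ha_instances_on_def)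
  then have "(\<Sum>I\<in>S. expected_size M I) \<le> of_nat 13"
    using le by (intro sum_expected_size_le[OF M S_sub]) blast
  \<comment> \<open>The numerator 18 is \<open>3 * 6\<close>: each of the six instances admits a
    matching of size 3.\<close>
  then have "ennreal (real 3 * real (card S) / real 13) \<le> approximation_ratio M"
    using three_list_max_matching_size_ge[OF assms(1)] card_S S_sub
    by (intro approximation_ratio_ge_average) (auto simp: S intro: card_ge_0_finite)
  moreover have "ennreal (real 3 * real (card S) / real 13) = 18 / 13"
    using divide_ennreal[of 18 13] by (simp add: card_S)
  ultimately show "18 / 13 \<le> approximation_ratio M"
    by simp
qed

end
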